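(* Let $(X,d)$ be a nonempty metric space with ball cover $\mathcal{B}$ and maximal-clique cover $\mathcal{M}$. For every $r\in\mathbb{R}_+$ there exist refinement maps $$f_r:\mathcal{M}(r)\to\mathcal{B}(r)\qquad\text{and}\qquad g_r:\mathcal{B}(r)\to\mathcal{M}(2r);$$ that is, $\mathcal{B}$ and $\mathcal{M}$ are $2$-approximated up to contiguity.
   Context: $\mathbb{R}_+=[0,\infty)$. A cover of a set $X$ is an indexed family $\mathcal{U}=\{U_i\}_{i\in I}$ of sets with $X=\bigcup_{i\in I}U_i$. A refinement map $\{V_j\}_{j\in J}\to\{U_i\}_{i\in I}$ is a function $f:J\to I$ with $V_j\subseteq U_{f(j)}$ for all $j$. The ball cover at scale $r$ is $\mathcal{B}(r)=\{B(x,r)\}_{x\in X}$, where $B(x,r)=\{y\in X: d(x,y)\le r\}$. A subset $M\subseteq X$ is an $r$-clique if $\mathrm{diam}(M)\le r$, and is maximal if it is not properly contained in another $r$-clique. The maximal-clique cover at scale $r$ is $\mathcal{M}(r)=\{M: M\text{ is a maximal } r\text{-clique}\}$. Families of covers $\mathcal{U}(r),\mathcal{V}(r)$, $r\in\mathbb{R}_+$, of $X$ (each increasing under refinement as $r$ grows) are $c$-approximated up to contiguity if for every $r$ there exist refinement maps $\mathcal{U}(r)\to\mathcal{V}(cr)$ and $\mathcal{V}(r)\to\mathcal{U}(cr)$. *)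

theory Defs
  imports "HOL-Analysis.Analysis"
begin

text \<open>An indexed family of sets: an index set \<open>I\<close> together with the assignment \<open>i \<mapsto> U\<^sub>i\<close>, of which
  only the values on \<open>I\<close> matter.\<close>

type_synonym ('i, 'a) set_family = "'i set \<times> ('i \<Rightarrow> 'a set)"

definition is_cover :: "'a set \<Rightarrow> ('i, 'a) set_family \<Rightarrow> bool" where
  "is_cover X U \<longleftrightarrow> X = (\<Union>i\<in>fst U. snd U i)"

definition refinement_map ::
    "('j \<Rightarrow> 'i) \<Rightarrow> ('j, 'a) set_family \<Rightarrow> ('i, 'a) set_family \<Rightarrow> bool" where
  "refinement_map f V U \<longleftrightarrow> f \<in> fst V \<rightarrow> fst U \<and> (\<forall>j\<in>fst V. snd V j \<subseteq> snd U (f j))"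

text \<open>Families of covers have scales in \<open>[0,\<infinity>)\<close>; values at negative scales are never used.\<close>

definition increasing_covers :: "'a set \<Rightarrow> (real \<Rightarrow> ('i, 'a) set_family) \<Rightarrow> bool" where
  "increasing_covers X U \<longleftrightarrow>
     (\<forall>r\<ge>0. is_cover X (U r)) \<and>
     (\<forall>r\<ge>0. \<forall>s\<ge>r. \<exists>f. refinement_map f (U r) (U s))"

definition approximated_up_to_contiguity ::
    "'a set \<Rightarrow> real \<Rightarrow> (real \<Rightarrow> ('i, 'a) set_family) \<Rightarrow> (real \<Rightarrow> ('j, 'a) set_family) \<Rightarrow> bool" where
  "approximated_up_to_contiguity X c U V \<longleftrightarrow>
     0 \<le> c \<and> increasing_covers X U \<and> increasing_covers X V \<and>
     (\<forall>r\<ge>0. (\<exists>f. refinement_map f (U r) (V (c * r))) \<and>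
            (\<exists>g. refinement_map g (V r) (U (c * r))))"

definition ball_cover :: "'a set \<Rightarrow> ('a \<Rightarrow> 'a \<Rightarrow> real) \<Rightarrow> real \<Rightarrow> ('a, 'a) set_family" where
  "ball_cover X d r = (X, \<lambda>x. Metric_space.mcball X d x r)"

text \<open>The diameter takes values in \<open>[0,\<infinity>]\<close>, so that unbounded sets have diameter \<open>\<infinity>\<close> (the real-valued
  constant \<^const>\<open>diameter\<close> is unspecified on them) and the empty set has diameter \<open>0\<close>.\<close>

definition ediam :: "('a \<Rightarrow> 'a \<Rightarrow> real) \<Rightarrow> 'a set \<Rightarrow> ennreal" where
  "ediam d M = (SUP x\<in>M. SUP y\<in>M. ennreal (d x y))"

definition clique :: "'a set \<Rightarrow> ('a \<Rightarrow> 'a \<Rightarrow> real) \<Rightarrow> real \<Rightarrow> 'a set \<Rightarrow> bool" where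
  "clique X d r M \<longleftrightarrow> M \<subseteq> X \<and> ediam d M \<le> ennreal r"

definition maximal_clique :: "'a set \<Rightarrow> ('a \<Rightarrow> 'a \<Rightarrow> real) \<Rightarrow> real \<Rightarrow> 'a set \<Rightarrow> bool" where
  "maximal_clique X d r M \<longleftrightarrow> clique X d r M \<and> \<not> (\<exists>N. clique X d r N \<and> M \<subset> N)"

text \<open>The set of maximal cliques, viewed as a family indexed by itself.\<close>

definition maximal_clique_cover ::
    "'a set \<Rightarrow> ('a \<Rightarrow> 'a \<Rightarrow> real) \<Rightarrow> real \<Rightarrow> ('a set, 'a) set_family" where
  "maximal_clique_cover X d r = ({M. maximal_clique X d r M}, \<lambda>M. M)"

end

theory Submission
  imports Defs
begin

text \<open>Every clique extends to a maximal one by Zorn's lemma. A maximal clique at scale \<open>r\<close> is nonempty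
  because \<open>X\<close> is, and it lies in the ball of radius \<open>r\<close> around any of its points; conversely, by the
  triangle inequality a ball of radius \<open>r\<close> is a \<open>2r\<close>-clique, hence contained in a maximal one.\<close>

text \<open>A supremum is bounded exactly when all its terms are. The sign of \<open>r\<close>
  matters: \<open>ennreal\<close> sends a negative \<open>r\<close> to 0, so singletons would still
  be cliques while \<open>d x x \<le> r\<close> fails.\<close>

lemma clique_iff:
  assumes "0 \<le> r"
  shows "clique X d r M \<longleftrightarrow> M \<subseteq> X \<and> (\<forall>x\<in>M. \<forall>y\<in>M. d x y \<le> r)"
  using assms by (simp add: clique_def ediam_def SUP_le_iff)

lemma clique_mono: "clique X d r M \<Longrightarrow> r \<le> s \<Longrightarrow> clique X d s M"
  unfolding clique_def by (meson ennreal_leI order_trans)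

lemma maximal_clique_extends:
  assumes "0 \<le> r" "clique X d r M"
  obtains N where "maximal_clique X d r N" "M \<subseteq> N"
proof -
  let ?A = "{N. clique X d r N \<and> M \<subseteq> N}"
  have "\<exists>N\<in>?A. \<forall>N'\<in>?A. N \<subseteq> N' \<longrightarrow> N' = N"
  proof (rule subset_Zorn_nonempty)
    show "?A \<noteq> {}" using assms by auto
  next
    fix C assume "C \<noteq> {}" and chain: "subset.chain ?A C"
    have C: "clique X d r N" "M \<subseteq> N" if "N \<in> C" for N
      using chain that by (auto simp: subset.chain_def)
    have "d x y \<le> r" if "x \<in> N" "N \<in> C" "y \<in> N'" "N' \<in> C" for x y N N'
    proof -
      \<comment> \<open>Both points lie in the larger of the two chain members, which is itself an
        \<open>r\<close>-clique.\<close>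
      have "N \<subseteq> N' \<or> N' \<subseteq> N"
        using chain that by (auto simp: subset_chain_def)
      then show ?thesis
        using C that assms(1) by (auto simp: clique_iff)
    qed
    moreover have "\<Union>C \<subseteq> X" using C by (auto simp: clique_def)
    \<comment> \<open>An empty chain has empty union, which need not contain \<open>M\<close>; hence
      the version of Zorn's lemma for nonempty chains.\<close>
    moreover have "M \<subseteq> \<Union>C" using C \<open>C \<noteq> {}\<close> by blast
    ultimately show "\<Union>C \<in> ?A"
      using assms(1) by (simp add: clique_iff)
  qed
  then obtain N where N: "N \<in> ?A" and max: "\<forall>N'\<in>?A. N \<subseteq> N' \<longrightarrow> N' = N" ..
  have "maximal_clique X d r N"
    unfolding maximal_clique_def
  proof (intro conjI notI)
    assume "\<exists>N'. clique X d r N' \<and> N \<subset> N'"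
    then obtain N' where "clique X d r N'" "N \<subset> N'" by blast
    with N max show False by auto
  qed (use N in simp)
  with N show thesis using that by simp
qed

text \<open>By the axiom of choice, refinements can be checked one member at a time, without naming
  the index map.\<close>

lemma ex_refinement_map_iff:
  "(\<exists>f. refinement_map f V U) \<longleftrightarrow> (\<forall>j\<in>fst V. \<exists>i\<in>fst U. snd V j \<subseteq> snd U i)"
proof
  assume "\<forall>j\<in>fst V. \<exists>i\<in>fst U. snd V j \<subseteq> snd U i"
  then obtain f where "\<forall>j\<in>fst V. f j \<in> fst U \<and> snd V j \<subseteq> snd U (f j)"
    unfolding Bex_def by (auto dest!: bchoice)
  then show "\<exists>f. refinement_map f V U"
    unfolding refinement_map_def by blast
qed (auto simp: refinement_map_def)

text \<open>Serves both for balls, which are cliques at the doubled scale, and for maximal cliques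
  of a smaller scale.\<close>

lemma refines_maximal_clique_cover:
  assumes "0 \<le> r" "\<And>j. j \<in> fst V \<Longrightarrow> clique X d r (snd V j)"
  shows "\<exists>f. refinement_map f V (maximal_clique_cover X d r)"
  unfolding ex_refinement_map_iff
proof
  fix j assume "j \<in> fst V"
  then obtain N where "maximal_clique X d r N" "snd V j \<subseteq> N"
    using maximal_clique_extends assms by blast
  then show "\<exists>i\<in>fst (maximal_clique_cover X d r). snd V j \<subseteq> snd (maximal_clique_cover X d r) i"
    by (auto simp: maximal_clique_cover_def)
qed

context Metric_space
begin

text \<open>Here and below, \<open>M\<close> is the whole space. Singletons show that maximal
  cliques are nonempty and, once extended, that they cover the space.\<close>

lemma clique_singleton: "0 \<le> r \<Longrightarrow> x \<in> M \<Longrightarrow> clique M d r {x}"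
  by (simp add: clique_iff)

lemma clique_mcball:
  assumes "0 \<le> r"
  shows "clique M d (2 * r) (mcball x r)"
proof -
  have "d y z \<le> 2 * r" if "y \<in> mcball x r" "z \<in> mcball x r" for y z
    using that triangle[of y x z] commute[of y x] by auto
  then show ?thesis
    using assms by (auto simp: clique_iff)
qed

lemma maximal_clique_subset_mcball:
  assumes "0 \<le> r" "M \<noteq> {}" "maximal_clique M d r N"
  obtains x where "x \<in> M" "N \<subseteq> mcball x r"
proof -
  have N: "clique M d r N" using assms(3) by (simp add: maximal_clique_def)
  \<comment> \<open>Otherwise the singleton of any point of the space would be a strictly larger
    clique.\<close>
  have "N \<noteq> {}"
    using assms clique_singleton unfolding maximal_clique_def by blast
  then obtain x where "x \<in> N" by blast
  then have "x \<in> M" "N \<subseteq> mcball x r"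
    using N assms(1) by (auto simp: clique_iff)
  then show thesis by (rule that)
qed

lemma maximal_clique_cover_refines_ball_cover:
  assumes "0 \<le> r" "M \<noteq> {}"
  shows "\<exists>f. refinement_map f (maximal_clique_cover M d r) (ball_cover M d r)"
  unfolding ex_refinement_map_iff
proof
  fix N assume "N \<in> fst (maximal_clique_cover M d r)"
  then have "maximal_clique M d r N" by (simp add: maximal_clique_cover_def)
  with assms obtain x where "x \<in> M" "N \<subseteq> mcball x r"
    by (rule maximal_clique_subset_mcball)
  then show "\<exists>x\<in>fst (ball_cover M d r). snd (maximal_clique_cover M d r) N \<subseteq> snd (ball_cover M d r) x"
    by (auto simp: maximal_clique_cover_def ball_cover_def)
qed

lemma ball_cover_refines_maximal_clique_cover:
  assumes "0 \<le> r"
  shows "\<exists>g. refinement_map g (ball_cover M d r) (maximal_clique_cover M d (2 * r))"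
  using assms by (intro refines_maximal_clique_cover) (simp_all add: ball_cover_def clique_mcball)

lemma ball_cover_mono:
  assumes "r \<le> s"
  shows "\<exists>f. refinement_map f (ball_cover M d r) (ball_cover M d s)"
  unfolding ex_refinement_map_iff ball_cover_def
  using mcball_subset_concentric[OF assms] by auto

lemma increasing_ball_cover: "increasing_covers M (ball_cover M d)"
  unfolding increasing_covers_def
  by (intro conjI allI impI ball_cover_mono) (auto simp: is_cover_def ball_cover_def)

lemma increasing_maximal_clique_cover: "increasing_covers M (maximal_clique_cover M d)"
  unfolding increasing_covers_def
proof (intro conjI allI impI)
  fix r :: real assume r: "0 \<le> r"
  have "\<exists>N. maximal_clique M d r N \<and> x \<in> N" if "x \<in> M" for x
    using maximal_clique_extends[OF r clique_singleton[OF r that]] by blast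
  then show "is_cover M (maximal_clique_cover M d r)"
    by (auto simp: is_cover_def maximal_clique_cover_def maximal_clique_def clique_def)
next
  fix r s :: real assume "0 \<le> r" "r \<le> s"
  \<comment> \<open>Maximality may be lost at the larger scale \<open>s\<close>, so \<open>N\<close>
    is kept only as a clique and extended anew.\<close>
  moreover have "clique M d s N" if "N \<in> fst (maximal_clique_cover M d r)" for N
  proof (rule clique_mono)
    show "clique M d r N"
      using that by (simp add: maximal_clique_cover_def maximal_clique_def)
  qed fact
  ultimately show "\<exists>f. refinement_map f (maximal_clique_cover M d r) (maximal_clique_cover M d s)"
    by (intro refines_maximal_clique_cover) (simp_all add: maximal_clique_cover_def)
qed

end

theorem theorem3p22:
  fixes X :: "'a set" and d :: "'a \<Rightarrow> 'a \<Rightarrow> real"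
  assumes "Metric_space X d" and "X \<noteq> {}"
  shows "(\<forall>r\<ge>0. (\<exists>f. refinement_map f (maximal_clique_cover X d r) (ball_cover X d r)) \<and>
                 (\<exists>g. refinement_map g (ball_cover X d r) (maximal_clique_cover X d (2 * r)))) \<and>
         approximated_up_to_contiguity X 2 (ball_cover X d) (maximal_clique_cover X d)"
proof -
  interpret Metric_space X d by fact
  \<comment> \<open>Contiguity asks for scale \<open>2 * r\<close> in both directions, so the
    sharper refinement into balls of radius \<open>r\<close> is followed by enlarging the
    balls.\<close>
  have "\<exists>f. refinement_map f (maximal_clique_cover X d r) (ball_cover X d (2 * r))" if "0 \<le> r" for r
  proof -
    have "r \<le> 2 * r" using that by simp
    from maximal_clique_cover_refines_ball_cover[OF that assms(2)] ball_cover_mono[OF this]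
    show ?thesis
      unfolding ex_refinement_map_iff by (meson subset_trans)
  qed
  then show ?thesis
    unfolding approximated_up_to_contiguity_def
    using assms(2) by (simp add: maximal_clique_cover_refines_ball_cover
        ball_cover_refines_maximal_clique_cover increasing_ball_cover increasing_maximal_clique_cover)
qed

end
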